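(* Let $r\ge 1$, let $q\in\mathbb{C}^\times$ be not a root of unity, let $\Lambda_1(z),\dots,\Lambda_r(z)$ be non-constant polynomials, $Q_1^+(z),\dots,Q_r^+(z)$ monic polynomials, and $\zeta_1,\dots,\zeta_r\in\mathbb{C}^\times$. Put $Q_0^+=Q_{r+1}^+=1$, $\zeta_0=\zeta_{r+1}=1$, $\xi_i=\zeta_i/\zeta_{i-1}$ for $i=1,\dots,r+1$, $Z=\prod_{i=1}^r\zeta_i^{\check\alpha_i}=\mathrm{diag}(\xi_1,\dots,\xi_{r+1})\in SL(r+1)$, and $$A(z)=\prod_{i=r}^{1} g_i(z)^{\check\alpha_i}\,e^{\frac{\Lambda_i(z)}{g_i(z)}e_i},\qquad g_i(z)=\zeta_i\frac{Q_i^+(qz)}{Q_i^+(z)} ,$$ where the factor with $i=r$ stands leftmost. Set $$\rho_i(z)=\Lambda_i(z)\frac{Q^+_{i-1}(qz)\,Q^+_{i+1}(z)}{Q^+_i(z)\,Q^+_i(qz)},\qquad i=1,\dots,r .$$ Suppose that $Q^-_{i,\dots,j}(z)$, $1\le i\le j\le r$, are polynomials such that the functions $\phi_{i,\dots,j}(z)=Q^-_{i,\dots,j}(z)/Q^+_j(z)$ (with $\phi_i=Q_i^-/Q_i^+$ for $j=i$) satisfy $$\xi_i\,\phi_i(z)-\xi_{i+1}\,\phi_i(qz)=\rho_i(z),\qquad 1\le i\le r,$$ $$\xi_i\,\phi_{i,\dots,j}(z)-\xi_{j+1}\,\phi_{i,\dots,j}(qz)=\rho_j(z)\,\phi_{i,\dots,j-1}(qz),\qquad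 1\le i<j\le r .$$ Then there exists $v(z)\in B_+(z)$ such that $$v(qz)^{-1}A(z)=Z\,v(z)^{-1},$$ and it is given by $$v(z)=\prod_{i=1}^r Q_i^+(z)^{\check\alpha_i}\cdot\prod_{i=1}^r V_i(z),\qquad V_i(z)=\prod_{j=i}^r\exp\bigl(-\phi_{i,\dots,j}(z)\,e_{i,\dots,j}\bigr),$$ where the factors of $\prod_{i=1}^rV_i(z)$ are ordered with $V_1$ leftmost, $e_{i,\dots,j}=[\dots[[e_i,e_{i+1}],e_{i+2}]\dots,e_j]$ for $j>i$, and the $j=i$ factor uses $e_i$.
   Context: $E_{ab}$ denotes the matrix unit. In the defining representation of $SL(r+1)$: $\check\alpha_i=E_{ii}-E_{i+1,i+1}$, $e_i=E_{i,i+1}$; for a nonzero rational function $u$, $u^{\check\alpha_i}$ is the diagonal matrix with $u$ in position $i$, $u^{-1}$ in position $i+1$ and $1$ elsewhere. $B_+(z)$ is the group of upper triangular matrices of determinant $1$ with entries in $\mathbb{C}(z)$. *)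

theory Defs
  imports
    "HOL-Computational_Algebra.Polynomial_Factorial"
    "HOL-Computational_Algebra.Field_as_Ring"
    "Jordan_Normal_Form.Determinant"
begin

type_synonym ratfun = "complex poly fract"

abbreviation cst :: "complex \<Rightarrow> ratfun" where
  "cst c \<equiv> to_fract [:c:]"

text \<open>The substitution \<open>f(z) \<mapsto> f(q z)\<close>, computed on the normalised quotient
  representing \<open>f\<close>; for \<open>q \<noteq> 0\<close> any other representation gives the same result,
  see \<open>qshift_Fract\<close>.\<close>

definition qshift :: "complex \<Rightarrow> ratfun \<Rightarrow> ratfun" where
  "qshift q f = (case quot_of_fract f of (a, b) \<Rightarrow> Fract (a \<circ>\<^sub>p [:0, q:]) (b \<circ>\<^sub>p [:0, q:]))"

lemma qshift_Fract:
  assumes "q \<noteq> 0" and "b \<noteq> 0"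
  shows "qshift q (Fract a b) = Fract (a \<circ>\<^sub>p [:0, q:]) (b \<circ>\<^sub>p [:0, q:])"
proof -
  obtain c d where cd: "quot_of_fract (Fract a b) = (c, d)" by fastforce
  have d: "d \<noteq> 0" using snd_quot_of_fract_nonzero[of "Fract a b"] cd by simp
  have "Fract c d = Fract a b"
    using Fract_quot_of_fract[of "Fract a b"] cd by simp
  hence "c * b = a * d" using assms d by (simp add: eq_fract)
  hence "(c \<circ>\<^sub>p [:0, q:]) * (b \<circ>\<^sub>p [:0, q:]) = (a \<circ>\<^sub>p [:0, q:]) * (d \<circ>\<^sub>p [:0, q:])"
    by (metis pcompose_mult)
  moreover have "b \<circ>\<^sub>p [:0, q:] \<noteq> 0" "d \<circ>\<^sub>p [:0, q:] \<noteq> 0"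
    using assms d by (simp_all add: pcompose_eq_0_iff)
  ultimately show ?thesis by (simp add: qshift_def cd eq_fract)
qed

text \<open>The mathematical indices run over \<open>1, \<dots>, n\<close>, those of \<^typ>\<open>'a mat\<close> over \<open>0, \<dots>, n - 1\<close>.\<close>

definition E :: "nat \<Rightarrow> nat \<Rightarrow> nat \<Rightarrow> ratfun mat" where
  "E n a b = mat n n (\<lambda>(k, l). if Suc k = a \<and> Suc l = b then 1 else 0)"

definition e :: "nat \<Rightarrow> nat \<Rightarrow> ratfun mat" where
  "e n i = E n i (i + 1)"

text \<open>\<open>u\<close> to the power of the \<open>i\<close>-th simple coroot.\<close>

definition coroot_pow :: "nat \<Rightarrow> nat \<Rightarrow> ratfun \<Rightarrow> ratfun mat" where
  "coroot_pow n i u = mat n n (\<lambda>(k, l).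
     if k \<noteq> l then 0
     else if Suc k = i then u
     else if Suc k = i + 1 then inverse u
     else 1)"

definition commutator :: "ratfun mat \<Rightarrow> ratfun mat \<Rightarrow> ratfun mat" where
  "commutator A B = A * B - B * A"

text \<open>The iterated commutator \<open>[\<dots>[[e\<^sub>i, e\<^sub>i\<^sub>+\<^sub>1], e\<^sub>i\<^sub>+\<^sub>2], \<dots>, e\<^sub>j]\<close>, which is \<open>e\<^sub>i\<close> for \<open>j = i\<close>.\<close>

definition e_seg :: "nat \<Rightarrow> nat \<Rightarrow> nat \<Rightarrow> ratfun mat" where
  "e_seg n i j = foldl (\<lambda>M k. commutator M (e n k)) (e n i) [i + 1..<j + 1]"

text \<open>The exponential series of a nilpotent matrix; its terms of index at least the
  dimension of the matrix vanish.\<close>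

definition nilp_exp :: "ratfun mat \<Rightarrow> ratfun mat" where
  "nilp_exp N = mat (dim_row N) (dim_row N)
     (\<lambda>(k, l). \<Sum>m<dim_row N. (N ^\<^sub>m m) $$ (k, l) / of_nat (fact m))"

definition mat_prod :: "nat \<Rightarrow> ratfun mat list \<Rightarrow> ratfun mat" where
  "mat_prod n Ms = foldr (*) Ms (1\<^sub>m n)"

definition B_plus :: "nat \<Rightarrow> ratfun mat set" where
  "B_plus n = {M \<in> carrier_mat n n. upper_triangular M \<and> det M = 1}"

text \<open>Matrix inversion, as inversion in the multiplicative monoid of the ring of
  \<open>n \<times> n\<close> matrices.\<close>

abbreviation mat_inv :: "nat \<Rightarrow> ratfun mat \<Rightarrow> ratfun mat" where
  "mat_inv n M \<equiv> inv\<^bsub>ring_mat TYPE(ratfun) n ()\<^esub> M"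

lemma mat_prod_diag:
  assumes "\<And>i. i \<in> set xs \<Longrightarrow> D i = mat n n (\<lambda>(k, l). if k = l then d i k else 0)"
  shows "mat_prod n (map D xs) = mat n n (\<lambda>(k, l). if k = l then \<Prod>i\<leftarrow>xs. d i k else 0)"
  using assms
proof (induction xs)
  case Nil
  show ?case by (rule eq_matI) (auto simp: mat_prod_def)
next
  case (Cons x xs)
  have "mat_prod n (map D (x # xs)) = D x * mat_prod n (map D xs)"
    by (simp add: mat_prod_def)
  also have "\<dots> = mat n n (\<lambda>(k, l). if k = l then d x k else 0) *
      mat n n (\<lambda>(k, l). if k = l then \<Prod>i\<leftarrow>xs. d i k else 0)"
    using Cons by simp
  also have "\<dots> = mat n n (\<lambda>(k, l). if k = l then \<Prod>i\<leftarrow>x # xs. d i k else 0)"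
  proof (rule eq_matI, goal_cases)
    case (1 k l)
    hence "k < n" "l < n" by auto
    thus ?case
      by (cases "k = l") (auto simp: scalar_prod_def if_distrib if_distribR cong: if_cong)
  qed auto
  finally show ?case .
qed

lemma mat_prod_coroot_pow:
  assumes "\<And>i. i \<in> {1..r} \<Longrightarrow> \<zeta> i \<noteq> (0::complex)" and "\<zeta> 0 = 1" and "\<zeta> (r + 1) = 1"
  shows "mat_prod (r + 1) (map (\<lambda>i. coroot_pow (r + 1) i (cst (\<zeta> i))) [1..<r + 1])
    = mat (r + 1) (r + 1) (\<lambda>(k, l). if k = l then cst (\<zeta> (Suc k) / \<zeta> k) else 0)"
proof -
  define d where "d i k = (if Suc k = i then cst (\<zeta> i)
      else if k = i then inverse (cst (\<zeta> i)) else 1)" for i k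
  have "coroot_pow (r + 1) i (cst (\<zeta> i)) =
      mat (r + 1) (r + 1) (\<lambda>(k, l). if k = l then d i k else 0)" for i
    by (rule eq_matI) (auto simp: coroot_pow_def d_def)
  hence "mat_prod (r + 1) (map (\<lambda>i. coroot_pow (r + 1) i (cst (\<zeta> i))) [1..<r + 1]) =
      mat (r + 1) (r + 1) (\<lambda>(k, l). if k = l then \<Prod>i\<leftarrow>[1..<r + 1]. d i k else 0)"
    by (intro mat_prod_diag)
  also have "\<dots> = mat (r + 1) (r + 1) (\<lambda>(k, l). if k = l then cst (\<zeta> (Suc k) / \<zeta> k) else 0)"
  proof (rule eq_matI, goal_cases)
    case (1 k l)
    hence k: "k \<le> r" "l \<le> r" by auto
    have inv: "inverse (cst c) = cst (inverse c)" if "c \<noteq> 0" for c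
      using that by (simp add: to_fract_def eq_fract one_pCons)
    have "(\<Prod>i\<leftarrow>[1..<r + 1]. d i k) = (\<Prod>i\<in>{1..r}. d i k)"
      by (metis Suc_eq_plus1 atLeastLessThanSuc_atLeastAtMost distinct_upt
          prod.distinct_set_conv_list set_upt)
    also have "\<dots> = (\<Prod>i\<in>{1..r}. (if Suc k = i then cst (\<zeta> i) else 1)
        * (if k = i then inverse (cst (\<zeta> i)) else 1))"
      by (intro prod.cong) (auto simp: d_def)
    also have "\<dots> = (if Suc k \<le> r then cst (\<zeta> (Suc k)) else 1)
        * (if 1 \<le> k then inverse (cst (\<zeta> k)) else 1)"
      using k by (auto simp: prod.distrib)
    also have "\<dots> = cst (\<zeta> (Suc k)) * cst (inverse (\<zeta> k))"
    proof -
      have "cst 1 = 1" by (simp add: one_pCons[symmetric])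
      moreover have "\<zeta> (Suc k) = 1" if "\<not> Suc k \<le> r"
      proof -
        have "Suc k = r + 1" using that k by simp
        thus ?thesis using assms(3) by simp
      qed
      moreover have "\<zeta> k = 1" if "\<not> 1 \<le> k"
        using that assms(2) by (cases k) auto
      moreover have "\<zeta> k \<noteq> 0"
        using assms(1,2) k by (cases "k = 0") auto
      ultimately show ?thesis using inv[of "\<zeta> k"] by simp
    qed
    also have "\<dots> = cst (\<zeta> (Suc k) / \<zeta> k)"
      by (simp add: to_fract_def divide_inverse mult.commute)
    finally have "(\<Prod>i\<leftarrow>[1..<r + 1]. d i k) = cst (\<zeta> (Suc k) / \<zeta> k)" .
    with k show ?case by (cases "k = l") (simp_all del: upt_Suc)
  qed auto
  finally show ?thesis .
qed

end

theory Submission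
  imports Defs
begin

text \<open>Since \<open>e\<^sub>i\<^sub>,\<^sub>\<dots>\<^sub>,\<^sub>j = E\<^sub>i\<^sub>,\<^sub>j\<^sub>+\<^sub>1\<close> squares to zero and the product over \<open>i\<close> is ordered
  increasingly, the inverse of the unipotent part of \<open>v\<close> is linear in the \<open>\<phi>\<close>'s: it is the
  unitriangular matrix \<open>U\<close> with entry \<open>\<phi>\<^sub>i\<^sub>,\<^sub>\<dots>\<^sub>,\<^sub>j\<close> in position \<open>(i, j + 1)\<close>. The order of the
  factors of \<open>A\<close> makes \<open>A\<close> upper bidiagonal, and conjugating it by the diagonal part of \<open>v\<close>
  (shifted on the left) gives the bidiagonal matrix \<open>B\<close> with diagonal \<open>\<xi>\<close> and superdiagonal
  \<open>\<rho>\<close>. The claim thus becomes \<open>U(qz) B(z) = Z U(z)\<close>, whose entries are the equations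
  assumed for \<open>\<phi>\<close>.\<close>

subsection \<open>The substitution as a field homomorphism\<close>

text \<open>For \<open>q \<noteq> 0\<close> the substitution is injective on polynomials, so
  denominators stay nonzero and any representative of a fraction may be used. As a homomorphism it
  passes entrywise through matrix products and inverses.\<close>

lemma field_hom_qshift:
  assumes "q \<noteq> 0"
  shows "field_hom (qshift q)"
proof
  note shift = qshift_Fract[OF assms]
  have nz: "b \<circ>\<^sub>p [:0, q:] \<noteq> 0" if "b \<noteq> 0" for b
    using that assms by (simp add: pcompose_eq_0_iff)
  show "qshift q 0 = 0" using shift[of 1 0] by (simp add: fract_collapse)
  show "qshift q 1 = 1" using shift[of 1 1] by (simp add: One_fract_def pcompose_1)
  fix x y :: ratfun
  obtain a b where x: "x = Fract a b" "b \<noteq> 0" by (cases x)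
  obtain c d where y: "y = Fract c d" "d \<noteq> 0" by (cases y)
  show "qshift q (x + y) = qshift q x + qshift q y"
    using x y nz by (simp add: shift pcompose_add pcompose_mult)
  show "qshift q (x * y) = qshift q x * qshift q y"
    using x y nz by (simp add: shift pcompose_mult)
qed

subsection \<open>Products of matrices\<close>

lemma mat_prod_carrier:
  assumes "\<And>M. M \<in> set Ms \<Longrightarrow> M \<in> carrier_mat n n"
  shows "mat_prod n Ms \<in> carrier_mat n n"
  using assms by (induction Ms) (auto simp: mat_prod_def intro!: mult_carrier_mat)

lemma mat_prod_Cons: "mat_prod n (M # Ms) = M * mat_prod n Ms"
  by (simp add: mat_prod_def)

lemma mat_prod_snoc:
  assumes "\<And>M'. M' \<in> set Ms \<Longrightarrow> M' \<in> carrier_mat n n" and "M \<in> carrier_mat n n"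
  shows "mat_prod n (Ms @ [M]) = mat_prod n Ms * M"
  using assms
proof (induction Ms)
  case Nil
  then show ?case by (simp add: mat_prod_def)
next
  case (Cons M' Ms)
  have "mat_prod n Ms \<in> carrier_mat n n" using Cons.prems by (intro mat_prod_carrier) auto
  then show ?case using Cons by (simp add: mat_prod_Cons assoc_mult_mat[of _ n n _ n _ n])
qed

text \<open>\<open>mat_prod\<close> unfolds at its first factor, whereas inductions over increasing
  index ranges add a last one; associativity bridges the two.\<close>

lemma mat_prod_map_upt_Suc:
  assumes "a \<le> b" and "\<And>i. a \<le> i \<Longrightarrow> i \<le> b \<Longrightarrow> F i \<in> carrier_mat n n"
  shows "mat_prod n (map F [a..<Suc b]) = mat_prod n (map F [a..<b]) * F b"
proof -
  have "map F [a..<Suc b] = map F [a..<b] @ [F b]" using assms(1) by simp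
  then show ?thesis using assms by (simp only:) (rule mat_prod_snoc, auto)
qed

lemma upper_triangular_mult:
  fixes M N :: "'a :: semiring_1 mat"
  assumes M: "M \<in> carrier_mat n n" "upper_triangular M"
    and N: "N \<in> carrier_mat n n" "upper_triangular N"
  shows "upper_triangular (M * N)"
proof (rule upper_triangularI)
  fix k l assume l: "l < k" and k: "k < dim_row (M * N)"
  have "M $$ (k, j) * N $$ (j, l) = 0" if "j < n" for j
  proof (cases "j < k")
    case True
    then show ?thesis using upper_triangularD[OF M(2) True] M(1) k by simp
  next
    case False
    then show ?thesis using upper_triangularD[OF N(2), of l j] N(1) l that by simp
  qed
  then show "(M * N) $$ (k, l) = 0"
    using M(1) N(1) k l by (auto simp: scalar_prod_def intro!: sum.neutral)
qed

lemma B_plus_mult: "M \<in> B_plus n \<Longrightarrow> N \<in> B_plus n \<Longrightarrow> M * N \<in> B_plus n"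
  by (auto simp: B_plus_def det_mult intro!: upper_triangular_mult)

lemma B_plus_mat_prod: "set Ms \<subseteq> B_plus n \<Longrightarrow> mat_prod n Ms \<in> B_plus n"
proof (induction Ms)
  case Nil
  then show ?case by (simp add: B_plus_def mat_prod_def)
next
  case (Cons M Ms)
  then show ?case by (simp add: mat_prod_Cons B_plus_mult)
qed

text \<open>Over a field a one-sided inverse of a square matrix is two-sided, so a single product
  identity determines the inverse in the monoid.\<close>

lemma mat_inv_eqI:
  assumes "M \<in> carrier_mat n n" "N \<in> carrier_mat n n" "M * N = 1\<^sub>m n"
  shows "mat_inv n M = N"
proof -
  interpret R: ring "ring_mat TYPE(ratfun) n ()" by (rule ring_mat)
  have "N * M = 1\<^sub>m n" using assms by (rule mat_mult_left_right_inverse)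
  then show ?thesis using assms by (intro R.inv_char) (auto simp: ring_mat_simps)
qed

subsection \<open>Matrix units and elementary unipotent matrices\<close>

lemma E_carrier: "E n a b \<in> carrier_mat n n"
  by (simp add: E_def)

text \<open>Right multiplication by \<open>E n a b\<close> moves column \<open>a\<close> to column
  \<open>b\<close> and clears all others; \<open>a - 1\<close> is column \<open>a\<close> counted
  from 0.\<close>

lemma mult_E_index:
  assumes "M \<in> carrier_mat n n" "1 \<le> a" "a \<le> n" "k < n" "l < n"
  shows "(M * E n a b) $$ (k, l) = (if Suc l = b then M $$ (k, a - 1) else 0)"
proof -
  have "(M * E n a b) $$ (k, l) =
      (\<Sum>j = 0..<n. if j = a - 1 then (if Suc l = b then M $$ (k, j) else 0) else 0)"
    using assms by (auto simp: E_def scalar_prod_def simp del: sum.delta intro!: sum.cong)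
  also have "\<dots> = (if Suc l = b then M $$ (k, a - 1) else 0)"
    using assms by (subst sum.delta) auto
  finally show ?thesis .
qed

lemma E_mult_E:
  assumes "1 \<le> c" "c \<le> n"
  shows "E n a b * E n c d = (if b = c then E n a d else 0\<^sub>m n n)"
proof (rule eq_matI)
  fix k l assume "k < dim_row (if b = c then E n a d else 0\<^sub>m n n)"
    and "l < dim_col (if b = c then E n a d else 0\<^sub>m n n)"
  then have kl: "k < n" "l < n" by (auto simp: E_def split: if_splits)
  show "(E n a b * E n c d) $$ (k, l) = (if b = c then E n a d else 0\<^sub>m n n) $$ (k, l)"
    unfolding mult_E_index[OF E_carrier assms kl] using assms kl by (auto simp: E_def)
qed (auto simp: E_def)

text \<open>Each further commutator extends the matrix unit by one column, since
  \<open>E n i (j + 1) * E n (j + 1) (j + 2) = E n i (j + 2)\<close>, while the product in the other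
  order vanishes because \<open>j + 2 \<noteq> i\<close>.\<close>

lemma e_seg_eq_E:
  assumes "1 \<le> i" "i \<le> j" "j < n"
  shows "e_seg n i j = E n i (j + 1)"
  using assms(2,3)
proof (induction j rule: dec_induct)
  case base
  show ?case by (simp add: e_seg_def e_def)
next
  case (step j)
  have "e_seg n i (Suc j) = commutator (e_seg n i j) (e n (Suc j))"
    using step by (simp add: e_seg_def)
  also have "\<dots> = E n i (Suc j + 1)"
    using step assms(1)
    by (auto simp: commutator_def e_def E_mult_E intro!: eq_matI) (auto simp: E_def)
  finally show ?case .
qed

text \<open>The series stops after its linear term; \<open>2 \<le> n\<close> ensures that the
  truncated sum over \<open>m < n\<close> still contains that term.\<close>

lemma nilp_exp_square_zero:
  assumes N: "N \<in> carrier_mat n n" "N * N = 0\<^sub>m n n" and n: "2 \<le> n"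
  shows "nilp_exp N = 1\<^sub>m n + N"
proof (rule eq_matI)
  have pow: "N ^\<^sub>m Suc (Suc m) = 0\<^sub>m n n" for m
  proof (induction m)
    case 0
    then show ?case using N by simp
  next
    case (Suc m)
    then show ?case using N(1) by (metis left_mult_zero_mat pow_mat.simps(2))
  qed
  fix k l assume "k < dim_row (1\<^sub>m n + N)" "l < dim_col (1\<^sub>m n + N)"
  then have kl: "k < n" "l < n" using N by auto
  have "nilp_exp N $$ (k, l) = (\<Sum>m<n. (N ^\<^sub>m m) $$ (k, l) / of_nat (fact m))"
    using N kl by (simp add: nilp_exp_def)
  also have "\<dots> = (\<Sum>m\<in>{0, 1}. (N ^\<^sub>m m) $$ (k, l) / of_nat (fact m))"
  proof (rule sum.mono_neutral_right)
    show "\<forall>m\<in>{..<n} - {0, 1}. (N ^\<^sub>m m) $$ (k, l) / of_nat (fact m) = 0"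
    proof
      fix m assume "m \<in> {..<n} - {0, 1}"
      then have "m = Suc (Suc (m - 2))" by auto
      then have "N ^\<^sub>m m = 0\<^sub>m n n" using pow by metis
      then show "(N ^\<^sub>m m) $$ (k, l) / of_nat (fact m) = 0" using kl by simp
    qed
  qed (use n in auto)
  also have "\<dots> = (1\<^sub>m n + N) $$ (k, l)" using N kl by simp
  finally show "nilp_exp N $$ (k, l) = (1\<^sub>m n + N) $$ (k, l)" .
qed (use N in \<open>auto simp: nilp_exp_def\<close>)

lemma nilp_exp_smult_E:
  assumes "1 \<le> a" "a < b" "b \<le> n"
  shows "nilp_exp (c \<cdot>\<^sub>m E n a b) = 1\<^sub>m n + c \<cdot>\<^sub>m E n a b"
proof (rule nilp_exp_square_zero)
  have "(c \<cdot>\<^sub>m E n a b) * (c \<cdot>\<^sub>m E n a b) = c \<cdot>\<^sub>m (c \<cdot>\<^sub>m (E n a b * E n a b))"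
    using E_carrier[of n a b]
    by (simp add: mult_smult_assoc_mat[of _ n n _ n] mult_smult_distrib[of _ n n _ n])
  also have "\<dots> = 0\<^sub>m n n" using assms by (simp add: E_mult_E)
  finally show "(c \<cdot>\<^sub>m E n a b) * (c \<cdot>\<^sub>m E n a b) = 0\<^sub>m n n" .
qed (use assms in \<open>auto simp: E_def\<close>)

lemma one_plus_E_in_B_plus:
  assumes "1 \<le> a" "a < b"
  shows "1\<^sub>m n + c \<cdot>\<^sub>m E n a b \<in> B_plus n"
proof -
  let ?M = "1\<^sub>m n + c \<cdot>\<^sub>m E n a b"
  have M: "?M \<in> carrier_mat n n" by (simp add: E_def)
  have ut: "upper_triangular ?M" using assms by (intro upper_triangularI) (auto simp: E_def)
  have "diag_mat ?M = map (\<lambda>_. 1) [0..<n]" using assms by (auto simp: diag_mat_def E_def)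
  then have "det ?M = 1" using det_upper_triangular[OF ut M] by (simp add: map_replicate_const)
  then show ?thesis using M ut by (simp add: B_plus_def)
qed

subsection \<open>Bidiagonal matrices\<close>

text \<open>Indices count from 0, and \<open>s k\<close> sits in row \<open>k\<close>, column
  \<open>k + 1\<close>. Diagonal matrices are the case \<open>s = 0\<close>, so one calculus serves
  \<open>A\<close>, \<open>Z\<close> and the diagonal part of \<open>v\<close>.\<close>

definition bidiag :: "nat \<Rightarrow> (nat \<Rightarrow> 'a) \<Rightarrow> (nat \<Rightarrow> 'a) \<Rightarrow> 'a :: zero mat" where
  "bidiag n d s = mat n n (\<lambda>(k, l). if k = l then d k else if l = Suc k then s k else 0)"

lemma bidiag_carrier: "bidiag n d s \<in> carrier_mat n n"
  by (simp add: bidiag_def)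

lemma bidiag_index:
  "k < n \<Longrightarrow> l < n \<Longrightarrow> bidiag n d s $$ (k, l) = (if k = l then d k else if l = Suc k then s k else 0)"
  by (simp add: bidiag_def)

lemma bidiag_cong:
  assumes "\<And>k. k < n \<Longrightarrow> d k = d' k" "\<And>k. Suc k < n \<Longrightarrow> s k = s' k"
  shows "bidiag n d s = bidiag n d' s'"
  by (rule eq_matI) (auto simp: bidiag_def assms)

lemma bidiag_mult_index:
  fixes M :: "'a :: semiring_1 mat"
  assumes "M \<in> carrier_mat n n" "k < n" "l < n"
  shows "(bidiag n d s * M) $$ (k, l) =
    d k * M $$ (k, l) + (if Suc k < n then s k * M $$ (Suc k, l) else 0)"
proof -
  have "(bidiag n d s * M) $$ (k, l) =
      (\<Sum>j = 0..<n. (if j = k then d k * M $$ (j, l) else 0)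
        + (if j = Suc k then s k * M $$ (j, l) else 0))"
    using assms by (auto simp: bidiag_def scalar_prod_def intro!: sum.cong)
  then show ?thesis using assms by (simp add: sum.distrib)
qed

lemma mult_bidiag_index:
  fixes M :: "'a :: semiring_1 mat"
  assumes "M \<in> carrier_mat n n" "k < n" "l < n"
  shows "(M * bidiag n d s) $$ (k, l) =
    M $$ (k, l) * d l + (if 0 < l then M $$ (k, l - 1) * s (l - 1) else 0)"
proof -
  \<comment> \<open>For \<open>l = 0\<close> the truncated \<open>l - 1\<close> is again 0, so the
    guard \<open>0 < l\<close> has to stay inside the second summand.\<close>
  have "(M * bidiag n d s) $$ (k, l) =
      (\<Sum>j = 0..<n. (if j = l then M $$ (k, j) * d j else 0)
        + (if j = l - 1 then (if 0 < l then M $$ (k, j) * s j else 0) else 0))"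
    using assms by (auto simp: bidiag_def scalar_prod_def intro!: sum.cong)
  also have "\<dots> = M $$ (k, l) * d l + (if 0 < l then M $$ (k, l - 1) * s (l - 1) else 0)"
    using assms unfolding sum.distrib by (subst sum.delta, simp, subst sum.delta) auto
  finally show ?thesis .
qed

lemma diag_mult_bidiag:
  fixes c d :: "nat \<Rightarrow> 'a :: semiring_1"
  shows "bidiag n c (\<lambda>_. 0) * bidiag n d s = bidiag n (\<lambda>k. c k * d k) (\<lambda>k. c k * s k)"
proof (rule eq_matI)
  fix k l assume "k < dim_row (bidiag n (\<lambda>k. c k * d k) (\<lambda>k. c k * s k))"
    and "l < dim_col (bidiag n (\<lambda>k. c k * d k) (\<lambda>k. c k * s k))"
  then have kl: "k < n" "l < n" by (auto simp: bidiag_def)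
  then show "(bidiag n c (\<lambda>_. 0) * bidiag n d s) $$ (k, l) =
      bidiag n (\<lambda>k. c k * d k) (\<lambda>k. c k * s k) $$ (k, l)"
    unfolding bidiag_mult_index[OF bidiag_carrier kl] by (auto simp: bidiag_index)
qed (auto simp: bidiag_def)

lemma bidiag_mult_diag:
  fixes c d :: "nat \<Rightarrow> 'a :: semiring_1"
  shows "bidiag n d s * bidiag n c (\<lambda>_. 0) = bidiag n (\<lambda>k. d k * c k) (\<lambda>k. s k * c (Suc k))"
proof (rule eq_matI)
  fix k l assume "k < dim_row (bidiag n (\<lambda>k. d k * c k) (\<lambda>k. s k * c (Suc k)))"
    and "l < dim_col (bidiag n (\<lambda>k. d k * c k) (\<lambda>k. s k * c (Suc k)))"
  then have kl: "k < n" "l < n" by (auto simp: bidiag_def)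
  then show "(bidiag n d s * bidiag n c (\<lambda>_. 0)) $$ (k, l) =
      bidiag n (\<lambda>k. d k * c k) (\<lambda>k. s k * c (Suc k)) $$ (k, l)"
    unfolding mult_bidiag_index[OF bidiag_carrier kl] by (auto simp: bidiag_index)
qed (auto simp: bidiag_def)

lemma one_eq_bidiag: "1\<^sub>m n = bidiag n (\<lambda>_. 1) (\<lambda>_. 0)"
  by (rule eq_matI) (auto simp: bidiag_def)

lemma coroot_pow_eq_bidiag:
  "coroot_pow n i u =
    bidiag n (\<lambda>k. if Suc k = i then u else if k = i then inverse u else 1) (\<lambda>_. 0)"
  by (rule eq_matI) (auto simp: bidiag_def coroot_pow_def)

text \<open>The bounds on \<open>i\<close> place both \<open>u\<close> and \<open>inverse u\<close>
  inside the matrix, so they cancel in the determinant.\<close>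

lemma coroot_pow_in_B_plus:
  assumes "1 \<le> i" "i < n" "u \<noteq> 0"
  shows "coroot_pow n i u \<in> B_plus n"
proof -
  let ?M = "coroot_pow n i u"
  have M: "?M \<in> carrier_mat n n" by (simp add: coroot_pow_def)
  have ut: "upper_triangular ?M" by (intro upper_triangularI) (auto simp: coroot_pow_def)
  have "det ?M = (\<Prod>k = 0..<n. ?M $$ (k, k))"
    using det_upper_triangular[OF ut M] M by (simp add: prod_list_diag_prod)
  also have "\<dots> = (\<Prod>k = 0..<n. (if k = i - 1 then u else 1) * (if k = i then inverse u else 1))"
    using assms by (intro prod.cong) (auto simp: coroot_pow_def)
  also have "\<dots> = u * inverse u"
    using assms unfolding prod.distrib by (subst prod.delta, simp, subst prod.delta) auto
  finally show ?thesis using M ut assms by (simp add: B_plus_def)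
qed

text \<open>Row \<open>k\<close>, counted from 0, receives \<open>u (Suc k)\<close> from one coroot
  and \<open>inverse (u k)\<close> from the preceding one. Stopping at \<open>m\<close> makes
  induction possible: values beyond \<open>m\<close> count as 1, and \<open>u 0 = 1\<close> covers
  the first row.\<close>

lemma mat_prod_coroot_pow_eq_bidiag:
  assumes "u 0 = 1" "m < n"
  shows "mat_prod n (map (\<lambda>i. coroot_pow n i (u i)) [1..<Suc m]) =
    bidiag n (\<lambda>k. (if k < m then u (Suc k) else 1) / (if k \<le> m then u k else 1)) (\<lambda>_. 0)"
  using assms(2)
proof (induction m)
  case 0
  then show ?case using assms(1)
    by (auto simp: mat_prod_def one_eq_bidiag intro!: bidiag_cong)
next
  case (Suc m)
  have "mat_prod n (map (\<lambda>i. coroot_pow n i (u i)) [1..<Suc (Suc m)]) =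
      mat_prod n (map (\<lambda>i. coroot_pow n i (u i)) [1..<Suc m]) * coroot_pow n (Suc m) (u (Suc m))"
    by (intro mat_prod_map_upt_Suc) (auto simp: coroot_pow_def)
  also have "\<dots> = bidiag n (\<lambda>k. (if k < Suc m then u (Suc k) else 1)
      / (if k \<le> Suc m then u k else 1)) (\<lambda>_. 0)"
    using Suc unfolding coroot_pow_eq_bidiag
    by (auto simp: diag_mult_bidiag le_Suc_eq field_simps intro!: bidiag_cong)
  finally show ?case .
qed

lemma mat_prod_coroot_pow_full:
  assumes "u 0 = 1" "u (r + 1) = 1"
  shows "mat_prod (r + 1) (map (\<lambda>i. coroot_pow (r + 1) i (u i)) [1..<r + 1]) =
    bidiag (r + 1) (\<lambda>k. u (Suc k) / u k) (\<lambda>_. 0)"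
  using mat_prod_coroot_pow_eq_bidiag[of u r "r + 1"] assms
  by (auto simp: less_Suc_eq intro!: bidiag_cong)

text \<open>The diagonal factor scales row \<open>i\<close> by \<open>u\<close>, which cancels the
  denominator of \<open>c / u\<close>. Hence the superdiagonal of \<open>A\<close> consists of the
  bare \<Lambda>'s.\<close>

lemma coroot_pow_mult_nilp_exp:
  assumes "1 \<le> i" "i < n" "u \<noteq> 0"
  shows "coroot_pow n i u * nilp_exp ((c / u) \<cdot>\<^sub>m e n i) =
    bidiag n (\<lambda>k. if Suc k = i then u else if k = i then inverse u else 1)
      (\<lambda>k. if Suc k = i then c else 0)"
proof -
  have "nilp_exp ((c / u) \<cdot>\<^sub>m e n i) = bidiag n (\<lambda>_. 1) (\<lambda>k. if Suc k = i then c / u else 0)"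
    using assms unfolding e_def
    by (subst nilp_exp_smult_E) (auto simp: E_def bidiag_def intro!: eq_matI)
  then show ?thesis
    using assms by (auto simp: coroot_pow_eq_bidiag diag_mult_bidiag intro!: bidiag_cong)
qed

text \<open>The factor with index \<open>m + 1\<close> is added on the left. Its superdiagonal entry
  meets row \<open>m + 1\<close> (from 0) of the previous product, which is still a unit row, so no
  second superdiagonal appears. The opposite order of factors would not have this property.\<close>

lemma mat_prod_rev_coroot_pow_exp:
  assumes "g 0 = 1" and "\<And>i. 1 \<le> i \<Longrightarrow> i \<le> m \<Longrightarrow> g i \<noteq> 0" and "m < n"
  shows "mat_prod n (map (\<lambda>i. coroot_pow n i (g i) * nilp_exp ((c i / g i) \<cdot>\<^sub>m e n i))
      (rev [1..<Suc m])) =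
    bidiag n (\<lambda>k. (if k < m then g (Suc k) else 1) / (if k \<le> m then g k else 1))
      (\<lambda>k. if k < m then c (Suc k) else 0)"
  using assms(2,3)
proof (induction m)
  case 0
  then show ?case using assms(1)
    by (auto simp: mat_prod_def one_eq_bidiag intro!: bidiag_cong)
next
  case (Suc m)
  let ?F = "\<lambda>i. coroot_pow n i (g i) * nilp_exp ((c i / g i) \<cdot>\<^sub>m e n i)"
  let ?B = "\<lambda>m. bidiag n (\<lambda>k. (if k < m then g (Suc k) else 1) / (if k \<le> m then g k else 1))
      (\<lambda>k. if k < m then c (Suc k) else 0)"
  have "mat_prod n (map ?F (rev [1..<Suc (Suc m)])) = ?F (Suc m) * ?B m"
    using Suc by (simp add: mat_prod_Cons)
  also have "?F (Suc m) = bidiag n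
      (\<lambda>k. if Suc k = Suc m then g (Suc m) else if k = Suc m then inverse (g (Suc m)) else 1)
      (\<lambda>k. if Suc k = Suc m then c (Suc m) else 0)"
    using Suc.prems by (intro coroot_pow_mult_nilp_exp) auto
  also have "\<dots> * ?B m = ?B (Suc m)"
  proof (rule eq_matI)
    fix k l assume "k < dim_row (?B (Suc m))" and "l < dim_col (?B (Suc m))"
    then have kl: "k < n" "l < n" by (auto simp: bidiag_def)
    show "(bidiag n
      (\<lambda>k. if Suc k = Suc m then g (Suc m) else if k = Suc m then inverse (g (Suc m)) else 1)
      (\<lambda>k. if Suc k = Suc m then c (Suc m) else 0) * ?B m) $$ (k, l) = ?B (Suc m) $$ (k, l)"
      unfolding bidiag_mult_index[OF bidiag_carrier kl] using kl Suc.prems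
      by (auto simp: bidiag_index le_Suc_eq less_Suc_eq field_simps)
  qed (auto simp: bidiag_def)
  finally show ?case .
qed

subsection \<open>The unipotent part\<close>

text \<open>A partial product of the factors of one \<open>V i\<close>. Column \<open>l\<close>
  counted from 0 is column \<open>l + 1\<close> of the mathematical indexing, so \<open>f j\<close>
  stands at position \<open>(i, j + 1)\<close>, matching \<open>e_seg\<close>.\<close>

definition row_unipotent :: "nat \<Rightarrow> nat \<Rightarrow> nat \<Rightarrow> (nat \<Rightarrow> 'a) \<Rightarrow> 'a :: zero_neq_one mat" where
  "row_unipotent n i m f =
    mat n n (\<lambda>(k, l). if k = l then 1 else if Suc k = i \<and> k < l \<and> l < m then f l else 0)"

text \<open>Here \<open>m\<close> counts the rows already filled, and \<open>f i j\<close> stands at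
  the mathematical position \<open>(i, j + 1)\<close>. With \<open>m = r\<close> and
  \<open>f = \<phi>\<close> this is the inverse of the unipotent part of \<open>v\<close>.\<close>

definition upper_unipotent :: "nat \<Rightarrow> nat \<Rightarrow> (nat \<Rightarrow> nat \<Rightarrow> 'a) \<Rightarrow> 'a :: zero_neq_one mat" where
  "upper_unipotent n m f =
    mat n n (\<lambda>(k, l). if k = l then 1 else if k < l \<and> k < m then f (Suc k) l else 0)"

text \<open>All factors live in row \<open>i\<close>, and products of two matrix units
  \<open>E n i a\<close>, \<open>E n i b\<close> with \<open>a, b > i\<close> vanish, so the linear
  terms simply add up.\<close>

lemma mat_prod_exp_e_seg:
  assumes "1 \<le> i" "i \<le> m" "m \<le> n"
  shows "mat_prod n (map (\<lambda>j. nilp_exp (f j \<cdot>\<^sub>m e_seg n i j)) [i..<m]) = row_unipotent n i m f"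
  using assms(2,3)
proof (induction m rule: dec_induct)
  case base
  show ?case by (rule eq_matI) (auto simp: mat_prod_def row_unipotent_def)
next
  case (step m)
  let ?X = "\<lambda>j. 1\<^sub>m n + f j \<cdot>\<^sub>m E n i (j + 1)"
  let ?R = "row_unipotent n i m f"
  have X: "nilp_exp (f j \<cdot>\<^sub>m e_seg n i j) = ?X j" if "i \<le> j" "j < n" for j
    using that assms(1) by (simp add: e_seg_eq_E nilp_exp_smult_E)
  have R: "?R \<in> carrier_mat n n" by (simp add: row_unipotent_def)
  have "mat_prod n (map (\<lambda>j. nilp_exp (f j \<cdot>\<^sub>m e_seg n i j)) [i..<Suc m]) = ?R * ?X m"
    using step X by (subst mat_prod_map_upt_Suc) (auto simp: E_def)
  also have "\<dots> = ?R + f m \<cdot>\<^sub>m (?R * E n i (m + 1))"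
    using R E_carrier[of n i "m + 1"]
    by (simp add: mult_add_distrib_mat[of _ n n _ n] mult_smult_distrib[of _ n n _ n])
  also have "\<dots> = row_unipotent n i (Suc m) f"
  proof (rule eq_matI)
    fix k l assume "k < dim_row (row_unipotent n i (Suc m) f)"
      and "l < dim_col (row_unipotent n i (Suc m) f)"
    then have kl: "k < n" "l < n" by (auto simp: row_unipotent_def)
    have "(?R + f m \<cdot>\<^sub>m (?R * E n i (m + 1))) $$ (k, l) =
        ?R $$ (k, l) + f m * (?R * E n i (m + 1)) $$ (k, l)"
      using kl R by (simp add: E_def)
    \<comment> \<open>Column \<open>i - 1\<close> of \<open>?R\<close> is a unit column, so this
      product is just \<open>E n i (m + 1)\<close>.\<close>
    also have "(?R * E n i (m + 1)) $$ (k, l) = (if Suc l = m + 1 then ?R $$ (k, i - 1) else 0)"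
      using step assms(1) kl by (intro mult_E_index[OF R]) auto
    finally show "(?R + f m \<cdot>\<^sub>m (?R * E n i (m + 1))) $$ (k, l) =
        row_unipotent n i (Suc m) f $$ (k, l)"
      using kl step assms(1) by (auto simp: row_unipotent_def)
  qed (auto simp: row_unipotent_def E_def)
  finally show ?case .
qed

lemma row_unipotent_mult_index:
  fixes M :: "'a :: semiring_1 mat"
  assumes "M \<in> carrier_mat n n" "k < n" "l < n"
  shows "(row_unipotent n i n f * M) $$ (k, l) =
    M $$ (k, l) + (if Suc k = i then \<Sum>j = i..<n. f j * M $$ (j, l) else 0)"
proof -
  have "(row_unipotent n i n f * M) $$ (k, l) =
      (\<Sum>j = 0..<n. (if j = k then M $$ (j, l) else 0)
        + (if Suc k = i \<and> k < j then f j * M $$ (j, l) else 0))"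
    using assms by (auto simp: row_unipotent_def scalar_prod_def intro!: sum.cong)
  also have "\<dots> = M $$ (k, l)
      + (\<Sum>j = 0..<n. if Suc k = i \<and> k < j then f j * M $$ (j, l) else 0)"
    using assms by (simp add: sum.distrib)
  also have "(\<Sum>j = 0..<n. if Suc k = i \<and> k < j then f j * M $$ (j, l) else 0) =
      (if Suc k = i then \<Sum>j = i..<n. f j * M $$ (j, l) else 0)"
  proof (cases "Suc k = i")
    case True
    then show ?thesis
      by (auto intro!: sum.mono_neutral_cong_right)
  next
    case False
    then show ?thesis by simp
  qed
  finally show ?thesis .
qed

text \<open>The left factor adds to row \<open>m\<close> (from 0) a combination of later rows, all
  of which are still unit rows. The values \<open>f (Suc m)\<close> are therefore written in
  unchanged, which is why no products of \<phi>'s arise.\<close>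

lemma row_unipotent_mult_upper_unipotent:
  fixes f :: "nat \<Rightarrow> nat \<Rightarrow> 'a :: semiring_1"
  shows "row_unipotent n (Suc m) n (f (Suc m)) * upper_unipotent n m f =
    upper_unipotent n (Suc m) f"
proof (rule eq_matI)
  fix k l assume "k < dim_row (upper_unipotent n (Suc m) f)"
    and "l < dim_col (upper_unipotent n (Suc m) f)"
  then have kl: "k < n" "l < n" by (auto simp: upper_unipotent_def)
  have U: "upper_unipotent n m f \<in> carrier_mat n n" by (simp add: upper_unipotent_def)
  have "(\<Sum>j = Suc m..<n. f (Suc m) j * upper_unipotent n m f $$ (j, l)) =
      (\<Sum>j = Suc m..<n. if j = l then f (Suc m) j else 0)"
    using kl by (intro sum.cong) (auto simp: upper_unipotent_def)
  also have "\<dots> = (if m < l then f (Suc m) l else 0)" using kl by auto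
  finally show "(row_unipotent n (Suc m) n (f (Suc m)) * upper_unipotent n m f) $$ (k, l) =
      upper_unipotent n (Suc m) f $$ (k, l)"
    unfolding row_unipotent_mult_index[OF U kl] using kl by (auto simp: upper_unipotent_def)
qed (auto simp: upper_unipotent_def row_unipotent_def)

text \<open>The part above the diagonal occupies a single row, so it squares to zero and negating it
  inverts the matrix.\<close>

lemma row_unipotent_inverse:
  fixes f :: "nat \<Rightarrow> 'a :: ring_1"
  shows "row_unipotent n i n f * row_unipotent n i n (\<lambda>j. - f j) = 1\<^sub>m n"
proof (rule eq_matI)
  fix k l assume "k < dim_row (1\<^sub>m n)" and "l < dim_col (1\<^sub>m n)"
  then have kl: "k < n" "l < n" by auto
  let ?R = "row_unipotent n i n (\<lambda>j. - f j)"
  have R: "?R \<in> carrier_mat n n" by (simp add: row_unipotent_def)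
  have "(\<Sum>j = i..<n. f j * ?R $$ (j, l)) = (\<Sum>j = i..<n. if j = l then f j else 0)"
    using kl by (intro sum.cong) (auto simp: row_unipotent_def)
  also have "\<dots> = (if i \<le> l then f l else 0)" using kl by auto
  finally show "(row_unipotent n i n f * ?R) $$ (k, l) = 1\<^sub>m n $$ (k, l)"
    unfolding row_unipotent_mult_index[OF R kl] using kl by (auto simp: row_unipotent_def)
qed (auto simp: row_unipotent_def)

text \<open>Inverting an increasing product reverses it: the inverse of each new last factor comes
  in on the left, exactly where it fills the next row of \<open>upper_unipotent\<close>. The minus
  signs in the exponentials disappear.\<close>

lemma upper_unipotent_mult_mat_prod:
  "upper_unipotent n m f * mat_prod n (map (\<lambda>i. row_unipotent n i n (\<lambda>j. - f i j)) [1..<Suc m]) =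
    1\<^sub>m n"
proof (induction m)
  case 0
  have "upper_unipotent n 0 f = 1\<^sub>m n" by (rule eq_matI) (auto simp: upper_unipotent_def)
  then show ?case by (simp add: mat_prod_def)
next
  case (Suc m)
  let ?R = "\<lambda>i. row_unipotent n i n (\<lambda>j. - f i j)"
  let ?P = "mat_prod n (map ?R [1..<Suc m])"
  let ?S = "row_unipotent n (Suc m) n (f (Suc m))"
  let ?U = "upper_unipotent n m f"
  have R: "?R i \<in> carrier_mat n n" for i by (simp add: row_unipotent_def)
  have P: "?P \<in> carrier_mat n n" using R by (intro mat_prod_carrier) auto
  have S: "?S \<in> carrier_mat n n" by (simp add: row_unipotent_def)
  have U: "?U \<in> carrier_mat n n" by (simp add: upper_unipotent_def)
  have "mat_prod n (map ?R [1..<Suc (Suc m)]) = ?P * ?R (Suc m)"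
    using R by (intro mat_prod_map_upt_Suc) auto
  then have "upper_unipotent n (Suc m) f * mat_prod n (map ?R [1..<Suc (Suc m)]) =
      (?S * ?U) * (?P * ?R (Suc m))"
    by (simp only: row_unipotent_mult_upper_unipotent)
  also have "\<dots> = ?S * ((?U * ?P) * ?R (Suc m))"
    using S U P R[of "Suc m"] by (simp add: assoc_mult_mat[of _ n n _ n _ n])
  also have "\<dots> = 1\<^sub>m n" using Suc R[of "Suc m"] by (simp add: row_unipotent_inverse)
  finally show ?case .
qed

section \<open>Assembly of \<open>v\<close> and the gauge equation\<close>

theorem theorem5p2:
  fixes r :: nat
    and q :: complex
    and \<Lambda> :: "nat \<Rightarrow> complex poly"
    and Qp :: "nat \<Rightarrow> complex poly"
    and Qm :: "nat \<Rightarrow> nat \<Rightarrow> complex poly"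
    and \<zeta> :: "nat \<Rightarrow> complex"
    and \<xi> :: "nat \<Rightarrow> complex"
    and g :: "nat \<Rightarrow> ratfun"
    and \<rho> :: "nat \<Rightarrow> ratfun"
    and \<phi> :: "nat \<Rightarrow> nat \<Rightarrow> ratfun"
    and Z A :: "ratfun mat"
    and V :: "nat \<Rightarrow> ratfun mat"
  assumes r: "r \<ge> 1"
    and q_nonzero: "q \<noteq> 0"
    and q_not_root_of_unity: "\<And>n. n > 0 \<Longrightarrow> q ^ n \<noteq> 1"
    and Lambda_nonconstant: "\<And>i. i \<in> {1..r} \<Longrightarrow> degree (\<Lambda> i) > 0"
    and Qp_monic: "\<And>i. i \<in> {1..r} \<Longrightarrow> lead_coeff (Qp i) = 1"
    and Qp_ends: "Qp 0 = 1" "Qp (r + 1) = 1"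
    and zeta_nonzero: "\<And>i. i \<in> {1..r} \<Longrightarrow> \<zeta> i \<noteq> 0"
    and zeta_ends: "\<zeta> 0 = 1" "\<zeta> (r + 1) = 1"
    and xi: "\<And>i. i \<in> {1..r + 1} \<Longrightarrow> \<xi> i = \<zeta> i / \<zeta> (i - 1)"
    and Z: "Z = mat_prod (r + 1) (map (\<lambda>i. coroot_pow (r + 1) i (cst (\<zeta> i))) [1..<r + 1])"
    and g: "\<And>i. i \<in> {1..r} \<Longrightarrow>
      g i = cst (\<zeta> i) * (qshift q (to_fract (Qp i)) / to_fract (Qp i))"
    and A: "A = mat_prod (r + 1)
      (map (\<lambda>i. coroot_pow (r + 1) i (g i) * nilp_exp ((to_fract (\<Lambda> i) / g i) \<cdot>\<^sub>m e (r + 1) i))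
        (rev [1..<r + 1]))"
    and rho: "\<And>i. i \<in> {1..r} \<Longrightarrow>
      \<rho> i = to_fract (\<Lambda> i)
        * ((qshift q (to_fract (Qp (i - 1))) * to_fract (Qp (i + 1)))
            / (to_fract (Qp i) * qshift q (to_fract (Qp i))))"
    and phi: "\<And>i j. 1 \<le> i \<Longrightarrow> i \<le> j \<Longrightarrow> j \<le> r \<Longrightarrow> \<phi> i j = to_fract (Qm i j) / to_fract (Qp j)"
    and phi_diag: "\<And>i. i \<in> {1..r} \<Longrightarrow>
      cst (\<xi> i) * \<phi> i i - cst (\<xi> (i + 1)) * qshift q (\<phi> i i) = \<rho> i"
    and phi_off_diag: "\<And>i j. 1 \<le> i \<Longrightarrow> i < j \<Longrightarrow> j \<le> r \<Longrightarrow>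
      cst (\<xi> i) * \<phi> i j - cst (\<xi> (j + 1)) * qshift q (\<phi> i j) = \<rho> j * qshift q (\<phi> i (j - 1))"
    and V: "\<And>i. i \<in> {1..r} \<Longrightarrow>
      V i = mat_prod (r + 1) (map (\<lambda>j. nilp_exp ((- \<phi> i j) \<cdot>\<^sub>m e_seg (r + 1) i j)) [i..<r + 1])"
  shows "\<exists>v \<in> B_plus (r + 1).
    mat_inv (r + 1) (map_mat (qshift q) v) * A = Z * mat_inv (r + 1) v \<and>
    v = mat_prod (r + 1) (map (\<lambda>i. coroot_pow (r + 1) i (to_fract (Qp i))) [1..<r + 1])
        * mat_prod (r + 1) (map V [1..<r + 1])"
proof -
  let ?n = "r + 1"
  interpret \<sigma>: field_hom "qshift q" by (rule field_hom_qshift[OF q_nonzero])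
  define P where "P i = to_fract (Qp i)" for i
  define S where "S i = qshift q (P i)" for i
  define c where "c i = cst (\<zeta> i)" for i
  \<comment> \<open>\<open>g\<close> is prescribed only for indices 1 to \<open>r\<close>;
    \<open>G\<close> follows the same formula everywhere, so \<open>G 0 = G (r + 1) = 1\<close> and
    the telescoping diagonal of \<open>A\<close> needs no special cases.\<close>
  define G where "G i = c i * (S i / P i)" for i
  \<comment> \<open>\<open>D\<close> and \<open>W\<close> are the diagonal and unipotent parts of
    \<open>v\<close>, with inverses \<open>D'\<close> and \<open>U\<close>; \<open>B\<close> is what
    \<open>A\<close> becomes after conjugation by the diagonal part.\<close>
  define D where "D = bidiag ?n (\<lambda>k. P (Suc k) / P k) (\<lambda>_. 0)"
  define D' where "D' = bidiag ?n (\<lambda>k. P k / P (Suc k)) (\<lambda>_. 0)"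
  define U where "U = upper_unipotent ?n r \<phi>"
  define W where "W = mat_prod ?n (map V [1..<?n])"
  define B where "B = bidiag ?n (\<lambda>k. cst (\<xi> (Suc k))) (\<lambda>k. \<rho> (Suc k))"

  have ends: "i = 0 \<or> i \<in> {1..r} \<or> i = r + 1" if "i \<le> r + 1" for i using that by auto
  have P_nz: "P i \<noteq> 0" if "i \<le> r + 1" for i
    using ends[OF that] Qp_monic[of i] Qp_ends by (auto simp: P_def)
  have S_nz: "S i \<noteq> 0" if "i \<le> r + 1" for i
    using P_nz[OF that] by (simp add: S_def)
  have zeta_nz: "\<zeta> i \<noteq> 0" if "i \<le> r + 1" for i
    using ends[OF that] zeta_nonzero zeta_ends by auto
  have c_nz: "c i \<noteq> 0" if "i \<le> r + 1" for i
    using zeta_nz[OF that] by (simp add: c_def)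
  have cst_1: "cst 1 = 1" by (simp add: one_pCons[symmetric])
  have P_ends: "P 0 = 1" "P (r + 1) = 1" using Qp_ends by (simp_all add: P_def)
  have S_ends: "S 0 = 1" "S (r + 1) = 1" using P_ends by (simp_all add: S_def)
  have c_ends: "c 0 = 1" "c (r + 1) = 1" using zeta_ends cst_1 by (simp_all add: c_def)
  have G_ends: "G 0 = 1" "G (r + 1) = 1" using P_ends S_ends c_ends by (simp_all add: G_def)
  have G_nz: "G i \<noteq> 0" if "i \<le> r + 1" for i
    using P_nz[OF that] S_nz[OF that] c_nz[OF that] by (simp add: G_def)
  have xi_c: "cst (\<xi> (Suc k)) = c (Suc k) / c k" if "k < r + 1" for k
    using xi[of "Suc k"] zeta_nz[of k] that
    by (simp add: c_def to_fract_def eq_fract)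

  have Z_eq: "Z = bidiag ?n (\<lambda>k. cst (\<xi> (Suc k))) (\<lambda>_. 0)"
    using mat_prod_coroot_pow_full[of c r] c_ends xi_c
    by (auto simp: Z c_def intro!: bidiag_cong)
  have D_eq: "mat_prod ?n (map (\<lambda>i. coroot_pow ?n i (to_fract (Qp i))) [1..<?n]) = D"
    using mat_prod_coroot_pow_full[of P r] P_ends by (simp add: P_def D_def)
  have A_eq: "A = bidiag ?n (\<lambda>k. G (Suc k) / G k) (\<lambda>k. to_fract (\<Lambda> (Suc k)))"
  proof -
    have "A = mat_prod ?n (map (\<lambda>i. coroot_pow ?n i (G i)
        * nilp_exp ((to_fract (\<Lambda> i) / G i) \<cdot>\<^sub>m e ?n i)) (rev [1..<Suc r]))"
      unfolding A using g
      by (intro arg_cong[where f = "mat_prod ?n"] map_cong) (auto simp: G_def c_def S_def P_def)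
    also have "\<dots> = bidiag ?n (\<lambda>k. G (Suc k) / G k) (\<lambda>k. to_fract (\<Lambda> (Suc k)))"
      using mat_prod_rev_coroot_pow_exp[of G r ?n "\<lambda>i. to_fract (\<Lambda> i)"] G_ends G_nz
      by (auto simp: less_Suc_eq intro!: bidiag_cong)
    finally show ?thesis .
  qed

  have D: "D \<in> carrier_mat ?n ?n" "D' \<in> carrier_mat ?n ?n"
    by (simp_all add: D_def D'_def bidiag_carrier)
  have U: "U \<in> carrier_mat ?n ?n" by (simp add: U_def upper_unipotent_def)
  have \<sigma>U: "map_mat (qshift q) U \<in> carrier_mat ?n ?n" using U by simp
  have B: "B \<in> carrier_mat ?n ?n" and A_carrier: "A \<in> carrier_mat ?n ?n"
    and Z_carrier: "Z \<in> carrier_mat ?n ?n"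
    by (simp_all add: B_def A_eq Z_eq bidiag_carrier)
  have V_eq: "V i = row_unipotent ?n i ?n (\<lambda>j. - \<phi> i j)" if "i \<in> {1..r}" for i
    using V[OF that] that mat_prod_exp_e_seg[of i ?n ?n "\<lambda>j. - \<phi> i j"] by simp
  have V_B: "V i \<in> B_plus ?n" if i: "i \<in> {1..r}" for i
    unfolding V[OF i]
  proof (rule B_plus_mat_prod, rule subsetI)
    fix M assume "M \<in> set (map (\<lambda>j. nilp_exp ((- \<phi> i j) \<cdot>\<^sub>m e_seg ?n i j)) [i..<?n])"
    then obtain j where j: "i \<le> j" "j < ?n" and M: "M = nilp_exp ((- \<phi> i j) \<cdot>\<^sub>m e_seg ?n i j)"
      by auto
    have "M = 1\<^sub>m ?n + (- \<phi> i j) \<cdot>\<^sub>m E ?n i (j + 1)"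
      unfolding M using i j by (simp add: e_seg_eq_E nilp_exp_smult_E)
    then show "M \<in> B_plus ?n" using i j by (simp add: one_plus_E_in_B_plus)
  qed
  have W_B: "W \<in> B_plus ?n" unfolding W_def using V_B by (intro B_plus_mat_prod) auto
  then have W: "W \<in> carrier_mat ?n ?n" by (simp add: B_plus_def)
  have D_B: "D \<in> B_plus ?n"
    unfolding D_eq[symmetric] using P_nz
    by (intro B_plus_mat_prod) (auto simp: P_def intro!: coroot_pow_in_B_plus)

  have UW: "U * W = 1\<^sub>m ?n"
  proof -
    have "W = mat_prod ?n (map (\<lambda>i. row_unipotent ?n i ?n (\<lambda>j. - \<phi> i j)) [1..<Suc r])"
      unfolding W_def using V_eq
      by (intro arg_cong[where f = "mat_prod ?n"] map_cong) auto
    then show ?thesis by (simp only: U_def upper_unipotent_mult_mat_prod)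
  qed
  have WU: "W * U = 1\<^sub>m ?n" using U W UW by (rule mat_mult_left_right_inverse)
  have DD': "D * D' = 1\<^sub>m ?n"
    using P_nz by (auto simp: D_def D'_def diag_mult_bidiag one_eq_bidiag intro!: bidiag_cong)
  have v_inv: "(D * W) * (U * D') = 1\<^sub>m ?n"
  proof -
    have "(D * W) * (U * D') = D * ((W * U) * D')"
      using D W U by (simp add: assoc_mult_mat[of _ ?n ?n _ ?n _ ?n])
    then show ?thesis using D by (simp add: WU DD')
  qed
  have inv_v: "mat_inv ?n (D * W) = U * D'"
    using D W U v_inv by (intro mat_inv_eqI) auto
  have inv_\<sigma>v: "mat_inv ?n (map_mat (qshift q) (D * W)) =
      map_mat (qshift q) U * map_mat (qshift q) D'"
  proof -
    \<comment> \<open>Applying the homomorphism to \<open>v_inv\<close> shows that the inverse of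
      the shifted \<open>v\<close> is the shifted inverse.\<close>
    have "map_mat (qshift q) (D * W) * map_mat (qshift q) (U * D') = 1\<^sub>m ?n"
      using \<sigma>.mat_hom_mult[of "D * W" ?n ?n "U * D'" ?n] D W U v_inv
      by (simp add: \<sigma>.mat_hom_one)
    then show ?thesis using D W U \<sigma>.mat_hom_mult[of U ?n ?n D' ?n]
      by (intro mat_inv_eqI) auto
  qed

  \<comment> \<open>On the diagonal the quotients of \<open>S\<close> and \<open>P\<close> contained
    in \<open>G\<close> cancel, leaving the \<xi>'s. On the superdiagonal the identity to check is
    \<open>S k / S (k + 1) * \<Lambda> = \<rho> * P (k + 1) / P (k + 2)\<close>, with \<Lambda> and
    \<rho> taken at \<open>k + 1\<close>; this is the definition of \<rho>.\<close>
  have conj: "map_mat (qshift q) D' * A = B * D'"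
  proof -
    have "map_mat (qshift q) D' = bidiag ?n (\<lambda>k. S k / S (Suc k)) (\<lambda>_. 0)"
      by (rule eq_matI) (auto simp: D'_def bidiag_def S_def \<sigma>.hom_div)
    then show ?thesis
      unfolding A_eq B_def D'_def using P_nz S_nz c_nz
      by (auto simp: diag_mult_bidiag bidiag_mult_diag xi_c rho G_def P_def[symmetric]
          S_def[symmetric] field_simps intro!: bidiag_cong)
  qed
  have main: "map_mat (qshift q) U * B = Z * U"
  proof (rule eq_matI)
    fix k l assume "k < dim_row (Z * U)" and "l < dim_col (Z * U)"
    then have kl: "k < ?n" "l < ?n" using Z_carrier U by auto
    have U_index: "U $$ (a, b) = (if a = b then 1 else if a < b then \<phi> (Suc a) b else 0)"
      if "a < ?n" "b < ?n" for a b
      using that by (auto simp: U_def upper_unipotent_def)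
    have \<sigma>U_index: "map_mat (qshift q) U $$ (a, b) =
        (if a = b then 1 else if a < b then qshift q (\<phi> (Suc a) b) else 0)"
      if "a < ?n" "b < ?n" for a b
      using that U by (simp add: U_index)
    have "(map_mat (qshift q) U * B) $$ (k, l) = map_mat (qshift q) U $$ (k, l) * cst (\<xi> (Suc l))
        + (if 0 < l then map_mat (qshift q) U $$ (k, l - 1) * \<rho> (Suc (l - 1)) else 0)"
      unfolding B_def by (rule mult_bidiag_index[OF \<sigma>U kl])
    also have "\<dots> = cst (\<xi> (Suc k)) * U $$ (k, l)"
    proof -
      \<comment> \<open>Below and on the diagonal both sides agree at once. On the superdiagonal
        \<open>map_mat (qshift q) U\<close> contributes its diagonal 1 next to \<rho>, giving
        \<open>phi_diag\<close> for \<open>i = l\<close>; further out the entry is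
        \<open>phi_off_diag\<close> for \<open>i = k + 1\<close>, \<open>j = l\<close>.\<close>
      consider "l < k" | "l = k" | "l = Suc k" | "Suc k < l" by linarith
      then show ?thesis
      proof cases
        case 3
        then show ?thesis using phi_diag[of l] kl
          by (simp add: U_index \<sigma>U_index algebra_simps)
      next
        case 4
        then show ?thesis using phi_off_diag[of "Suc k" l] kl
          by (simp add: U_index \<sigma>U_index algebra_simps)
      qed (use kl in \<open>auto simp: U_index \<sigma>U_index\<close>)
    qed
    also have "\<dots> = (Z * U) $$ (k, l)"
      unfolding Z_eq bidiag_mult_index[OF U kl] by simp
    finally show "(map_mat (qshift q) U * B) $$ (k, l) = (Z * U) $$ (k, l)" .
  qed (use U B Z_carrier in auto)

  \<comment> \<open>\<open>A\<close> is carried leftwards to right: first \<open>conj\<close> moves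
    it past the diagonal part as \<open>B\<close>, then \<open>main\<close> turns \<open>B\<close>
    into \<open>Z\<close> on the other side of \<open>U\<close>.\<close>
  have "mat_inv ?n (map_mat (qshift q) (D * W)) * A = map_mat (qshift q) U * (map_mat (qshift q) D' * A)"
    unfolding inv_\<sigma>v using \<sigma>U D A_carrier by (intro assoc_mult_mat) auto
  also have "\<dots> = (map_mat (qshift q) U * B) * D'"
    unfolding conj using \<sigma>U B D by (intro assoc_mult_mat[symmetric]) auto
  also have "\<dots> = Z * mat_inv ?n (D * W)"
    unfolding main inv_v using Z_carrier U D by (intro assoc_mult_mat) auto
  finally have "mat_inv ?n (map_mat (qshift q) (D * W)) * A = Z * mat_inv ?n (D * W)" .
  moreover have "D * W \<in> B_plus ?n" using D_B W_B by (rule B_plus_mult)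
  ultimately show ?thesis unfolding D_eq W_def by blast
qed

end
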